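(* Let $p$ be an odd prime, and let $a$ be an odd integer such that $\left(\frac{a}{p}\right) = -1$ (Legendre symbol). Then for any even integer $k \geq 6$ and any integer $n$ with $2pn+a \geq 1$, $$b_k(2pn+a) \equiv 0 \pmod{16}.$$
   Context: For an integer $j$ write $\sigma_j(n) := \sum_{d \mid n} d^j$, the sum over positive divisors of $n \ge 1$. For even $k \geq 6$ and integers $n \geq 1$ define $$b_6(n) := \frac{(n^2-n+1)\sigma_1(n) - \sigma_3(n)}{6}, \qquad b_k(n) := \frac{-n^2\sigma_{k-7}(n) + (n^2+1)\sigma_{k-5}(n) - \sigma_{k-3}(n)}{24} \quad (k \geq 8).$$ These numbers are integers for all $n\ge 1$. *)

theory Defs
  imports "HOL-Number_Theory.Number_Theory"
begin

definition divisor_sigma :: "int \<Rightarrow> nat \<Rightarrow> rat" where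
  "divisor_sigma j n = (\<Sum>d | d dvd n. of_nat d powi j)"

(* The quotients by 6 and 24 are exact rational ones, so no rounding is hidden in the
   definition; that the values are integers is a theorem.  The function is meant for
   even k >= 6 and n >= 1 only. *)
definition b :: "int \<Rightarrow> nat \<Rightarrow> rat" where
  "b k n =
    (if k = 6 then
       ((of_nat n ^ 2 - of_nat n + 1) * divisor_sigma 1 n - divisor_sigma 3 n) / 6
     else
       (- (of_nat n ^ 2) * divisor_sigma (k - 7) n
          + (of_nat n ^ 2 + 1) * divisor_sigma (k - 5) n
          - divisor_sigma (k - 3) n) / 24)"

(* A congruence between rational numbers that are required to be integers: cong used
   directly on type rat would be trivial, since rat is a field. *)
definition int_cong :: "rat \<Rightarrow> int \<Rightarrow> int \<Rightarrow> bool" where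
  "int_cong x c m \<longleftrightarrow> (\<exists>z::int. x = of_int z \<and> [z = c] (mod m))"

end

(* Write e = N / d for a divisor d of N.  Both formulas for b_k(N) are, up to the factor 1/24
   (1/6 if k = 6), the divisor sum of d^(k-5) (d^2 - 1) (e^2 - 1).  The congruence on N makes it
   a non-residue modulo p, hence not a square, so the divisors split into pairs {d, e} with
   d < e, and each pair contributes (d^(k-5) + e^(k-5)) (d^2 - 1) (e^2 - 1).  As N is odd this is
   divisible by 2 * 8 * 8, and it is always divisible by 3, hence by 384 = 24 * 16. *)
theory Submission
  imports Defs
begin

text \<open>The numerator of \<open>b k N\<close> for \<open>m\<close> = k - 5, over the denominator
  6 or 24. It lives in \<open>int\<close> because divisibility in the field \<open>rat\<close> would
  say nothing.\<close>

definition paired_divisor_sum :: "nat \<Rightarrow> nat \<Rightarrow> int" where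
  "paired_divisor_sum m N = (\<Sum>d | d dvd N. int d ^ m * (int d ^ 2 - 1) * (int (N div d) ^ 2 - 1))"

lemma eight_dvd_odd_square_minus_one:
  fixes x :: int
  assumes "odd x"
  shows "8 dvd x ^ 2 - 1"
proof -
  obtain c where c: "x = 2 * c + 1" using assms by (elim oddE)
  \<comment> \<open>Here x^2 - 1 = 4 c (c + 1), so the parity of a product of consecutive integers
    supplies the last factor 2.\<close>
  have "even (c * (c + 1))" by simp
  then obtain t where "c * (c + 1) = 2 * t" by (elim evenE)
  then have "x ^ 2 - 1 = 8 * t"
    unfolding c by (simp add: power2_eq_square algebra_simps)
  then show ?thesis by simp
qed

lemma three_dvd_square_minus_one:
  fixes x :: int
  assumes "\<not> 3 dvd x"
  shows "3 dvd x ^ 2 - 1"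
proof -
  have "x mod 3 = 1 \<or> x mod 3 = 2" using assms by presburger
  then have "3 dvd x - 1 \<or> 3 dvd x + 1" by presburger
  moreover have "x ^ 2 - 1 = (x - 1) * (x + 1)"
    by (simp add: power2_eq_square algebra_simps)
  ultimately show ?thesis by auto
qed

text \<open>The factor 3 comes from the power sum if 3 divides both \<open>d\<close> and
  \<open>e\<close>, which is where \<open>m > 0\<close> enters, and otherwise from one of the
  factors d^2 - 1, e^2 - 1. It is coprime to 2 * 8 * 8 = 128.\<close>

lemma dvd_divisor_pair_term:
  fixes d e :: int
  assumes "odd d" "odd e" "m > 0"
  shows "384 dvd (d ^ m + e ^ m) * ((d ^ 2 - 1) * (e ^ 2 - 1))" (is "_ dvd ?t")
proof -
  have "2 * (8 * 8) dvd ?t"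
    using assms by (intro mult_dvd_mono eight_dvd_odd_square_minus_one) auto
  moreover have "3 dvd ?t"
  proof (cases "3 dvd d \<and> 3 dvd e")
    case True
    then have "3 dvd d ^ m + e ^ m"
      using \<open>m > 0\<close> by (intro dvd_add) (auto intro: dvd_trans[OF _ dvd_power])
    then show ?thesis by (rule dvd_mult2)
  next
    case False
    then have "3 dvd d ^ 2 - 1 \<or> 3 dvd e ^ 2 - 1"
      using three_dvd_square_minus_one by blast
    then show ?thesis by auto
  qed
  ultimately show ?thesis by presburger
qed

text \<open>The involution d -> N / d on the divisors has no fixed point when \<open>N\<close> is
  not a square, so it exchanges the divisors below their cofactor (\<open>A\<close>) with those
  above it (\<open>B\<close>).\<close>

lemma sum_divisors_pair:
  fixes f :: "nat \<Rightarrow> 'a :: comm_monoid_add"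
  assumes "N > 0" and nonsquare: "\<And>c. c * c \<noteq> N"
  shows "(\<Sum>d | d dvd N. f d) = (\<Sum>d | d dvd N \<and> d < N div d. f d + f (N div d))"
proof -
  define A where "A = {d. d dvd N \<and> d < N div d}"
  define B where "B = {d. d dvd N \<and> N div d < d}"
  have fin: "finite {d. d dvd N}" using \<open>N > 0\<close> by simp
  have "d \<noteq> N div d" if "d dvd N" for d
    using that nonsquare[of d] by (metis dvd_mult_div_cancel)
  then have union: "{d. d dvd N} = A \<union> B"
    unfolding A_def B_def using nat_neq_iff by blast
  have "sum f B = (\<Sum>d\<in>A. f (N div d))"
    by (rule sum.reindex_bij_witness[of _ "\<lambda>d. N div d" "\<lambda>d. N div d"])
      (use \<open>N > 0\<close> in \<open>auto simp: A_def B_def elim!: dvdE split: if_splits\<close>)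
  moreover have "(\<Sum>d | d dvd N. f d) = sum f A + sum f B"
    unfolding union by (rule sum.union_disjoint)
      (use fin in \<open>auto simp: A_def B_def\<close>)
  ultimately show ?thesis
    by (simp add: sum.distrib A_def)
qed

lemma dvd_paired_divisor_sum:
  assumes "odd N" "m > 0" and nonsquare: "\<And>c. c * c \<noteq> N"
  shows "384 dvd paired_divisor_sum m N"
proof -
  have "N > 0" using \<open>odd N\<close> by (rule odd_pos)
  have "paired_divisor_sum m N = (\<Sum>d | d dvd N \<and> d < N div d.
      (int d ^ m + int (N div d) ^ m) * ((int d ^ 2 - 1) * (int (N div d) ^ 2 - 1)))"
    unfolding paired_divisor_sum_def sum_divisors_pair[OF \<open>N > 0\<close> nonsquare]
    using \<open>N > 0\<close> by (intro sum.cong) (auto simp: algebra_simps)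
  also have "384 dvd \<dots>"
  proof (rule dvd_sum)
    fix d assume "d \<in> {d. d dvd N \<and> d < N div d}"
    then have "odd d" "odd (N div d)"
      using \<open>odd N\<close> by (auto dest: dvd_trans) (metis dvd_mult_div_cancel even_mult_iff)
    then show "384 dvd (int d ^ m + int (N div d) ^ m) * ((int d ^ 2 - 1) * (int (N div d) ^ 2 - 1))"
      using \<open>m > 0\<close> by (intro dvd_divisor_pair_term) auto
  qed
  finally show ?thesis .
qed

text \<open>Let e = N / d. For exponent 1 the product contains the term d e^2 = N e. As e also runs
  through all divisors, these terms add up to N sigma_1(N), which explains the -n in the coefficient
  n^2 - n + 1.\<close>

lemma b_6_eq:
  assumes "N > 0"
  shows "b 6 N = of_int (paired_divisor_sum 1 N) / 6"
proof -
  let ?D = "{d. d dvd N}" and ?N = "of_nat N :: rat"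
  have "(\<Sum>d\<in>?D. of_nat d * of_nat (N div d) ^ 2) = (\<Sum>d\<in>?D. ?N * of_nat (N div d))"
    by (rule sum.cong)
      (auto simp: power2_eq_square simp flip: mult.assoc of_nat_mult)
  also have "\<dots> = ?N * (\<Sum>d\<in>?D. of_nat d)"
    unfolding sum_distrib_left
    by (rule sum.reindex_bij_witness[of _ "\<lambda>d. N div d" "\<lambda>d. N div d"])
      (use assms in auto)
  finally have cross: "(\<Sum>d\<in>?D. of_nat d * of_nat (N div d) ^ 2) = ?N * (\<Sum>d\<in>?D. of_nat d)" .
  have "of_int (paired_divisor_sum 1 N) =
      (\<Sum>d\<in>?D. (?N ^ 2 + 1) * of_nat d - of_nat d ^ 3 - of_nat d * of_nat (N div d) ^ 2)"
    unfolding paired_divisor_sum_def of_int_sum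
  proof (rule sum.cong)
    fix d assume "d \<in> ?D"
    then have N: "?N = of_nat d * of_nat (N div d)"
      by (simp flip: of_nat_mult)
    show "of_int (int d ^ 1 * (int d ^ 2 - 1) * (int (N div d) ^ 2 - 1)) =
        (?N ^ 2 + 1) * of_nat d - of_nat d ^ 3 - of_nat d * of_nat (N div d) ^ 2"
      unfolding N by (simp add: algebra_simps power2_eq_square power3_eq_cube)
  qed simp
  also have "\<dots> = (?N ^ 2 - ?N + 1) * divisor_sigma 1 N - divisor_sigma 3 N"
    unfolding sum_subtractf cross divisor_sigma_def sum_distrib_left[symmetric]
    by (simp add: algebra_simps power_int_numeral)
  finally show ?thesis by (simp add: b_def)
qed

text \<open>Expand the product and use d e = N: d^(j+4) e^2 = N^2 d^(j+2) and d^(j+2) e^2 = N^2 d^j.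
  Writing k = j + 7 makes all exponents natural numbers, so \<open>powi\<close> becomes an ordinary
  power.\<close>

lemma b_eq:
  "b (int j + 7) N = of_int (paired_divisor_sum (j + 2) N) / 24"
proof -
  let ?D = "{d. d dvd N}" and ?N = "of_nat N :: rat"
  have powi: "of_nat d powi (int j + 2) = (of_nat d ^ (j + 2) :: rat)"
    "of_nat d powi (int j + 4) = (of_nat d ^ (j + 4) :: rat)" for d
    using power_int_of_nat[of "of_nat d :: rat" "j + 2"]
      power_int_of_nat[of "of_nat d :: rat" "j + 4"] by (simp_all only: of_nat_add of_nat_numeral)
  have "of_int (paired_divisor_sum (j + 2) N) =
      (\<Sum>d\<in>?D. - (?N ^ 2) * of_nat d ^ j + (?N ^ 2 + 1) * of_nat d ^ (j + 2) - of_nat d ^ (j + 4))"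
    unfolding paired_divisor_sum_def of_int_sum
  proof (rule sum.cong)
    fix d assume "d \<in> ?D"
    then have N: "?N = of_nat d * of_nat (N div d)"
      by (simp flip: of_nat_mult)
    show "of_int (int d ^ (j + 2) * (int d ^ 2 - 1) * (int (N div d) ^ 2 - 1)) =
        - (?N ^ 2) * of_nat d ^ j + (?N ^ 2 + 1) * of_nat d ^ (j + 2) - of_nat d ^ (j + 4)"
      unfolding N by (simp add: algebra_simps power_add power2_eq_square power4_eq_xxxx)
  qed simp
  also have "\<dots> = - (?N ^ 2) * divisor_sigma (int j) N
      + (?N ^ 2 + 1) * divisor_sigma (int j + 2) N - divisor_sigma (int j + 4) N"
    unfolding divisor_sigma_def powi power_int_of_nat sum_subtractf sum.distrib sum_distrib_left ..
  finally show ?thesis by (simp add: b_def add.commute)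
qed

text \<open>A square congruent to \<open>a\<close> would make \<open>a\<close> a quadratic residue,
  whose Legendre symbol is 0 or 1.\<close>

lemma not_square_if_Legendre_minus_one:
  assumes "Legendre a p = -1" and "[x = a] (mod p)"
  shows "y * y \<noteq> x"
proof
  assume "y * y = x"
  then have "QuadRes p a"
    using assms(2) unfolding QuadRes_def power2_eq_square by blast
  then show False
    using assms(1) by (simp add: Legendre_def split: if_splits)
qed

theorem theorem3p2:
  fixes p :: nat and a k n :: int
  assumes "prime p" and "odd p"
    and "odd a" and "Legendre a (int p) = -1"
    and "even k" and "k \<ge> 6"
    and "2 * int p * n + a \<ge> 1"
  shows "int_cong (b k (nat (2 * int p * n + a))) 0 16"
proof -
  define N where "N = nat (2 * int p * n + a)"
  have N: "int N = 2 * int p * n + a" using assms(7) by (simp add: N_def)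
  \<comment> \<open>The summand 2pn is even and a multiple of p, so \<open>N\<close> inherits from
    \<open>a\<close> both its parity and its residue modulo p.\<close>
  have "odd (int N)" unfolding N using \<open>odd a\<close> by simp
  then have "odd N" by simp
  then have "N > 0" by (rule odd_pos)
  have "[int N = a] (mod int p)" unfolding N by (simp add: cong_iff_dvd_diff)
  then have nonsquare: "c * c \<noteq> N" for c
    using not_square_if_Legendre_minus_one[OF assms(4), of "int N" "int c"]
    by (simp flip: of_nat_mult)
  note dvd = dvd_paired_divisor_sum[OF \<open>odd N\<close> _ nonsquare]
  show ?thesis
  proof (cases "k = 6")
    case True
    \<comment> \<open>The denominator is only 6 here, so the quotient is even a multiple of 384 / 6
      = 64.\<close>
    obtain t where "paired_divisor_sum 1 N = 384 * t" using dvd[of 1] by (auto elim: dvdE)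
    then have "b k N = of_int (64 * t)" by (simp add: True b_6_eq[OF \<open>N > 0\<close>])
    moreover have "[64 * t = 0] (mod 16)" by (simp add: cong_0_iff)
    ultimately show ?thesis unfolding int_cong_def N_def by blast
  next
    case False
    then have "k - 7 \<ge> 0" using \<open>k \<ge> 6\<close> by simp
    then obtain j where "k - 7 = int j" by (rule nonneg_int_cases)
    then have k: "k = int j + 7" by simp
    \<comment> \<open>The exponent k - 5 is j + 2, and 384 / 24 = 16 is exactly the modulus.\<close>
    obtain t where "paired_divisor_sum (j + 2) N = 384 * t"
      using dvd[of "j + 2"] by (auto elim: dvdE)
    then have "b k N = of_int (16 * t)" by (simp add: k b_eq)
    moreover have "[16 * t = 0] (mod 16)" by (simp add: cong_0_iff)
    ultimately show ?thesis unfolding int_cong_def N_def by blast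
  qed
qed

end
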